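(* Assume that the relaxation parameters $\vec\omega=(\omega_v)_{v\in\mathcal V}$ are admissible. If the system $A\vec x=\vec b$ is consistent and the initial estimate satisfies $\vec x^{(0)}\in\mathcal R(A^* )$, then the sequence of estimates $\{\vec x^{(n)}\}$ of the distributed Kaczmarz algorithm, given by the recursion $$\vec x^{(n+1)}=Q^{\vec\omega}\vec x^{(n)}=\sum_{\ell\in\mathcal L}w(r,\ell)\,Q_\ell^{\vec\omega}\cdots Q_r^{\vec\omega}\,\vec x^{(n)},\qquad n\ge 0,$$ converges to the solution of $A\vec x=\vec b$ of minimal norm.
   Context: Setting. Let $A\in\mathbb C^{k\times d}$, $\vec b\in\mathbb C^k$. $\|\cdot\|$ is the Euclidean norm, $\langle\vec x,\vec y\rangle=\vec y^*\vec x$, and $\mathcal R,\mathcal N$ denote range and kernel. The network is a finite rooted tree with $k$ vertices, vertex set $\mathcal V$ and root $r$. The equations are indexed by the vertices: the row of $A$ indexed by $v$ is $\vec a_v^*$ (with $\vec a_v\in\mathbb C^d$ nonzero) and the corresponding equation is $\vec a_v^*\vec x=b_v$. Write $u\preceq v$ if $u=v$ or $u$ lies on the path from $r$ to $v$, and $u\to v$ if $v$ is a child of $u$. A leaf is a vertex without children; $\mathcal L$ is the set of leaves. A weight $w$ is a positive function on pairs $u\preceq v$ with $\sum_{v:\,u\to v}w(u,v)=1$ for every $u\notin\mathcal L$ and $w(u,v)=\prod_{j=1}^{J-1}w(u_j,u_{j+1})$ whenever $u=u_1\to u_2\to\cdots\to u_J=v$ (so $w(u,u)=1$). The weight $w$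 is fixed. Subnetworks. A subnetwork is a nonempty set $G$ of vertices (with the tree edges between them) such that: (1) if $u\in G$ and $x$ is the parent of $u$, then every child of $x$ is in $G$; (2) if $u\in G$ then every child of $u$ is in $G$; (3) for all $u,v\in G$, the path from $u$ to $v$ in the tree does not include $r$. Pairwise disjoint subnetworks $G_1,\dots,G_c$ are fixed such that every leaf belongs to one of them. Each $G_i$ has a single vertex $g_i$ immediately preceding it: $g_i\notin G_i$ and every $\preceq$-minimal vertex of $G_i$ is a child of $g_i$. The leaves in $G_i$ are $\ell_{i,1},\dots,\ell_{i,t_i}$, and $r_{i,j}$ is the $\preceq$-minimal vertex of $G_i$ with $r_{i,j}\preceq\ell_{i,j}$ (the root of the largest tree in $G_i$ containing $\ell_{i,j}$). Operators. Each vertex $v$ has a real relaxation parameter $\omega_v$. Put $$P_v\vec x=\vec x-\frac{\vec a_v^*\vec x}{\|\vec a_v\|^2}\vec a_v,\quad Q_v\vec x=\vec x+\frac{b_v-\vec a_v^*\vec x}{\|\vec a_v\|^2}\vec a_v,\quad P_v^{\vec\omega}=(1-\omega_v)I+\omega_vP_v,\quad Q_v^{\vec\omega}=(1-\omega_v)I+\omega_vQ_v.$$ For $u\preceq v$ with path $u=u_1\to\cdots\to u_J=v$, $P_v^{\vec\omega}\cdots P_u^{\vec\omega}$ denotes the composition $P_{u_J}^{\vec\omega}\cdots P_{u_1}^{\vec\omega}$ along the path (the operator at $u$ applied first), and similarly for $Q$. Set $P_{G_i}^{\vec\omega}=\sum_{j=1}^{t_i}w(g_i,\ell_{i,j})P_{\ell_{i,j}}^{\vec\omega}\cdots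 P_{r_{i,j}}^{\vec\omega}$. Admissibility. The relaxation parameters are admissible if: (1) $\omega_v\in(0,2)$ for every $v$ not belonging to any $G_i$; and (2) for each $i\in\{1,\dots,c\}$ there is a constant $\alpha_i<1$ with $\|P_{G_i}^{\vec\omega}\vec x\|\le\alpha_i\|\vec x\|$ for all $\vec x\in\mathrm{span}\{\vec a_u:u\in G_i\}$. *)

theory Defs
  imports "HOL-Analysis.Analysis"
begin

section \<open>Rooted trees\<close>

text \<open>The vertices of the tree are all the elements of a finite type, \<open>E\<close> is the (undirected)
  adjacency relation and \<open>r\<close> is the root.\<close>

definition is_path :: "('v \<Rightarrow> 'v \<Rightarrow> bool) \<Rightarrow> 'v \<Rightarrow> 'v list \<Rightarrow> 'v \<Rightarrow> bool" where
  "is_path E u p v \<longleftrightarrow> p \<noteq> [] \<and> hd p = u \<and> last p = v \<and> distinct p \<and> successively E p"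

definition is_tree :: "('v \<Rightarrow> 'v \<Rightarrow> bool) \<Rightarrow> bool" where
  "is_tree E \<longleftrightarrow> symp E \<and> irreflp E \<and> (\<forall>u v. \<exists>!p. is_path E u p v)"

definition tpath :: "('v \<Rightarrow> 'v \<Rightarrow> bool) \<Rightarrow> 'v \<Rightarrow> 'v \<Rightarrow> 'v list" where
  "tpath E u v = (THE p. is_path E u p v)"

definition preceq :: "('v \<Rightarrow> 'v \<Rightarrow> bool) \<Rightarrow> 'v \<Rightarrow> 'v \<Rightarrow> 'v \<Rightarrow> bool" where
  "preceq E r u v \<longleftrightarrow> u = v \<or> u \<in> set (tpath E r v)"

text \<open>\<open>child E r u v\<close> is \<open>u \<rightarrow> v\<close>: the vertex \<open>v\<close> is a child of \<open>u\<close>.\<close>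

definition child :: "('v \<Rightarrow> 'v \<Rightarrow> bool) \<Rightarrow> 'v \<Rightarrow> 'v \<Rightarrow> 'v \<Rightarrow> bool" where
  "child E r u v \<longleftrightarrow> E u v \<and> preceq E r u v"

definition leaves :: "('v \<Rightarrow> 'v \<Rightarrow> bool) \<Rightarrow> 'v \<Rightarrow> 'v set" where
  "leaves E r = {v. \<nexists>u. child E r v u}"

text \<open>The values of \<open>w\<close> off the pairs \<open>u \<preceq> v\<close> are irrelevant.\<close>

definition is_weight :: "('v::finite \<Rightarrow> 'v \<Rightarrow> bool) \<Rightarrow> 'v \<Rightarrow> ('v \<Rightarrow> 'v \<Rightarrow> real) \<Rightarrow> bool" where
  "is_weight E r w \<longleftrightarrow>
     (\<forall>u v. preceq E r u v \<longrightarrow> w u v > 0) \<and>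
     (\<forall>u. u \<notin> leaves E r \<longrightarrow> (\<Sum>v | child E r u v. w u v) = 1) \<and>
     (\<forall>us. us \<noteq> [] \<and> successively (child E r) us \<longrightarrow>
        w (hd us) (last us) = (\<Prod>j<length us - 1. w (us ! j) (us ! Suc j)))"

section \<open>Subnetworks\<close>

definition subnetwork :: "('v \<Rightarrow> 'v \<Rightarrow> bool) \<Rightarrow> 'v \<Rightarrow> 'v set \<Rightarrow> bool" where
  "subnetwork E r G \<longleftrightarrow> G \<noteq> {} \<and>
     (\<forall>u\<in>G. \<forall>x. child E r x u \<longrightarrow> (\<forall>y. child E r x y \<longrightarrow> y \<in> G)) \<and>
     (\<forall>u\<in>G. \<forall>y. child E r u y \<longrightarrow> y \<in> G) \<and>
     (\<forall>u\<in>G. \<forall>v\<in>G. r \<notin> set (tpath E u v))"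

definition minimal_in :: "('v \<Rightarrow> 'v \<Rightarrow> bool) \<Rightarrow> 'v \<Rightarrow> 'v set \<Rightarrow> 'v \<Rightarrow> bool" where
  "minimal_in E r G u \<longleftrightarrow> u \<in> G \<and> (\<forall>v\<in>G. preceq E r v u \<longrightarrow> v = u)"

definition immediately_precedes :: "('v \<Rightarrow> 'v \<Rightarrow> bool) \<Rightarrow> 'v \<Rightarrow> 'v \<Rightarrow> 'v set \<Rightarrow> bool" where
  "immediately_precedes E r g G \<longleftrightarrow> g \<notin> G \<and> (\<forall>u. minimal_in E r G u \<longrightarrow> child E r g u)"

definition subroot :: "('v \<Rightarrow> 'v \<Rightarrow> bool) \<Rightarrow> 'v \<Rightarrow> 'v set \<Rightarrow> 'v \<Rightarrow> 'v" where
  "subroot E r G l = (THE u. minimal_in E r G u \<and> preceq E r u l)"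

section \<open>The linear system\<close>

definition cadjoint :: "complex ^ 'd ^ 'v \<Rightarrow> complex ^ 'v ^ 'd" where
  "cadjoint A = map_matrix cnj (transpose A)"

text \<open>The row of \<open>A\<close> with index \<open>v\<close> is the conjugate transpose of the column vector \<open>avec A v\<close>,
  so that \<open>(A *v x) $ v\<close> is \<open>hprod (avec A v) x\<close>.\<close>

definition avec :: "complex ^ 'd ^ 'v \<Rightarrow> 'v \<Rightarrow> complex ^ 'd" where
  "avec A v = (\<chi> j. cnj (A $ v $ j))"

text \<open>\<open>hprod a x\<close> is \<open>a\<^sup>* x\<close>, conjugate-linear in the first argument; the library's
  \<open>a \<bullet> x\<close> is only its real part.\<close>

definition hprod :: "complex ^ 'd \<Rightarrow> complex ^ 'd \<Rightarrow> complex" where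
  "hprod a x = (\<Sum>j\<in>UNIV. cnj (a $ j) * x $ j)"

definition min_norm_solution ::
    "complex ^ 'd ^ 'v \<Rightarrow> complex ^ 'v \<Rightarrow> complex ^ 'd \<Rightarrow> bool" where
  "min_norm_solution A b z \<longleftrightarrow>
     A *v z = b \<and> (\<forall>y. A *v y = b \<and> y \<noteq> z \<longrightarrow> norm z < norm y)"

section \<open>The distributed Kaczmarz algorithm\<close>

definition Pop :: "complex ^ 'd ^ 'v \<Rightarrow> 'v \<Rightarrow> complex ^ 'd \<Rightarrow> complex ^ 'd" where
  "Pop A v x =
     x - (hprod (avec A v) x / of_real ((norm (avec A v))\<^sup>2)) *s avec A v"

definition Qop :: "complex ^ 'd ^ 'v \<Rightarrow> complex ^ 'v \<Rightarrow> 'v \<Rightarrow> complex ^ 'd \<Rightarrow> complex ^ 'd" where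
  "Qop A b v x =
     x + ((b $ v - hprod (avec A v) x) / of_real ((norm (avec A v))\<^sup>2)) *s avec A v"

definition Prelax ::
    "complex ^ 'd ^ 'v \<Rightarrow> ('v \<Rightarrow> real) \<Rightarrow> 'v \<Rightarrow> complex ^ 'd \<Rightarrow> complex ^ 'd" where
  "Prelax A \<omega> v x = (1 - \<omega> v) *\<^sub>R x + \<omega> v *\<^sub>R Pop A v x"

definition Qrelax ::
    "complex ^ 'd ^ 'v \<Rightarrow> complex ^ 'v \<Rightarrow> ('v \<Rightarrow> real) \<Rightarrow> 'v \<Rightarrow> complex ^ 'd \<Rightarrow> complex ^ 'd" where
  "Qrelax A b \<omega> v x = (1 - \<omega> v) *\<^sub>R x + \<omega> v *\<^sub>R Qop A b v x"

text \<open>\<open>along E F u v\<close> composes the operators \<open>F\<close> along the path from \<open>u\<close> to \<open>v\<close>; as \<open>fold\<close> starts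
  at the head of the list, \<open>F u\<close> is applied first and \<open>F v\<close> last.\<close>

definition along :: "('v \<Rightarrow> 'v \<Rightarrow> bool) \<Rightarrow> ('v \<Rightarrow> 'x \<Rightarrow> 'x) \<Rightarrow> 'v \<Rightarrow> 'v \<Rightarrow> 'x \<Rightarrow> 'x" where
  "along E F u v = fold F (tpath E u v)"

definition Psub ::
    "('v::finite \<Rightarrow> 'v \<Rightarrow> bool) \<Rightarrow> 'v \<Rightarrow> ('v \<Rightarrow> 'v \<Rightarrow> real) \<Rightarrow> complex ^ 'd ^ 'v \<Rightarrow> ('v \<Rightarrow> real) \<Rightarrow>
       'v \<Rightarrow> 'v set \<Rightarrow> complex ^ 'd \<Rightarrow> complex ^ 'd" where
  "Psub E r w A \<omega> g G x =
     (\<Sum>l\<in>G \<inter> leaves E r. w g l *\<^sub>R along E (Prelax A \<omega>) (subroot E r G l) l x)"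

definition Qnet ::
    "('v::finite \<Rightarrow> 'v \<Rightarrow> bool) \<Rightarrow> 'v \<Rightarrow> ('v \<Rightarrow> 'v \<Rightarrow> real) \<Rightarrow> complex ^ 'd ^ 'v \<Rightarrow> complex ^ 'v \<Rightarrow>
       ('v \<Rightarrow> real) \<Rightarrow> complex ^ 'd \<Rightarrow> complex ^ 'd" where
  "Qnet E r w A b \<omega> x = (\<Sum>l\<in>leaves E r. w r l *\<^sub>R along E (Qrelax A b \<omega>) r l x)"

text \<open>\<open>vec.span\<close> is the span over the scalar field \<open>complex\<close>; the constant \<open>span\<close> would be the
  real span.\<close>

definition admissible ::
    "('v::finite \<Rightarrow> 'v \<Rightarrow> bool) \<Rightarrow> 'v \<Rightarrow> ('v \<Rightarrow> 'v \<Rightarrow> real) \<Rightarrow> complex ^ 'd ^ 'v \<Rightarrow>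
       nat \<Rightarrow> (nat \<Rightarrow> 'v set) \<Rightarrow> (nat \<Rightarrow> 'v) \<Rightarrow> ('v \<Rightarrow> real) \<Rightarrow> bool" where
  "admissible E r w A c G g \<omega> \<longleftrightarrow>
     (\<forall>v. v \<notin> (\<Union>i\<in>{1..c}. G i) \<longrightarrow> \<omega> v \<in> {0<..<2}) \<and>
     (\<forall>i\<in>{1..c}. \<exists>\<alpha><1. \<forall>x\<in>vec.span (avec A ` G i).
        norm (Psub E r w A \<omega> (g i) (G i) x) \<le> \<alpha> * norm x)"

end

theory Submission
  imports Defs
begin

text \<open>Call \<open>T\<close> contracting off the kernel of a set \<open>U\<close> of rows if it fixes every vector orthogonal
  to these rows and strictly shrinks every other vector. This property is stable under composition
  and under convex combination, the sets of rows being united; it holds for a relaxed projection with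
  parameter in \<open>(0, 2)\<close> and, by admissibility, for the operator of a subnetwork. Propagating it up
  the tree, from the subnetworks to the root, shows that the homogeneous network operator contracts
  off the kernel of \<open>A\<close>; by compactness it is then a uniform contraction on the row span, where the
  error of the iteration lives.\<close>

section \<open>Rooted trees\<close>

lemma is_path_split:
  assumes "is_path E a (p @ u # q) b"
  shows "is_path E a (p @ [u]) u" and "is_path E u (u # q) b"
  using assms unfolding is_path_def
  by (auto simp: successively_append_iff hd_append split: if_splits)

locale rooted_tree =
  fixes E :: "'v::finite \<Rightarrow> 'v \<Rightarrow> bool" and r :: 'v
  assumes tree: "is_tree E"
begin

lemma is_path_tpath: "is_path E u (tpath E u v) v"
  using tree unfolding is_tree_def tpath_def by (metis theI')

lemma tpath_eqI: "is_path E u p v \<Longrightarrow> tpath E u v = p"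
  using tree is_path_tpath unfolding is_tree_def by blast

lemma tpath_self [simp]: "tpath E v v = [v]"
  by (rule tpath_eqI) (simp add: is_path_def)

lemma tpath_Cons: "\<exists>q. tpath E u v = u # q"
  using is_path_tpath[of u v] unfolding is_path_def by (metis list.collapse)

lemma tpath_snoc: "\<exists>q. tpath E u v = q @ [v]"
  using is_path_tpath[of u v] unfolding is_path_def by (metis append_butlast_last_id)

lemma preceq_iff: "preceq E r u v \<longleftrightarrow> u \<in> set (tpath E r v)"
  unfolding preceq_def using tpath_snoc[of r v] by auto

lemma preceq_refl [simp]: "preceq E r v v"
  by (simp add: preceq_def)

lemma preceq_root [simp]: "preceq E r r v"
  using tpath_Cons[of r v] by (auto simp: preceq_iff)

text \<open>Cutting the path from the root at a vertex leaves two simple paths, and uniqueness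
  identifies each with the corresponding tree path. The order facts below become list manipulations
  through this.\<close>

lemma tpath_split:
  assumes "preceq E r u v"
  shows "\<exists>p q. tpath E r u = p @ [u] \<and> tpath E u v = u # q \<and> tpath E r v = p @ u # q"
proof -
  obtain p q where pq: "tpath E r v = p @ u # q"
    using assms by (meson preceq_iff split_list)
  with is_path_tpath[of r v] is_path_split[of E r p u q v]
  have "tpath E r u = p @ [u]" "tpath E u v = u # q"
    by (auto intro!: tpath_eqI)
  with pq show ?thesis by blast
qed

text \<open>The two-vertex list \<open>[u, v]\<close> is the path from a parent to its child, so the
  root path grows by exactly one vertex. In this form every statement about children is a list
  equation.\<close>

lemma child_iff: "child E r u v \<longleftrightarrow> tpath E r v = tpath E r u @ [v]"
proof
  assume c: "child E r u v"
  then have "E u v" "preceq E r u v" by (auto simp: child_def)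
  moreover have "u \<noteq> v"
    using \<open>E u v\<close> tree by (auto simp: is_tree_def irreflp_def)
  ultimately have "tpath E u v = [u, v]"
    by (intro tpath_eqI) (auto simp: is_path_def)
  with tpath_split[OF \<open>preceq E r u v\<close>] show "tpath E r v = tpath E r u @ [v]"
    by auto
next
  assume eq: "tpath E r v = tpath E r u @ [v]"
  obtain q where q: "tpath E r u = q @ [u]" using tpath_snoc by blast
  have "successively E (tpath E r v)" using is_path_tpath by (simp add: is_path_def)
  with eq q have "E u v" by (simp add: successively_append_iff)
  with eq q show "child E r u v" by (simp add: child_def preceq_iff)
qed

section \<open>The order and the child relation\<close>

lemma preceq_trans:
  assumes "preceq E r u v" "preceq E r v x" shows "preceq E r u x"
  using assms tpath_split[OF assms(2)] by (auto simp: preceq_iff)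

text \<open>Depth grows strictly along the order, which supplies a measure for descending to minimal
  vertices.\<close>

lemma preceq_length:
  assumes "preceq E r u v" "u \<noteq> v"
  shows "length (tpath E r u) < length (tpath E r v)"
proof -
  obtain p q where pq: "tpath E r u = p @ [u]" "tpath E u v = u # q" "tpath E r v = p @ u # q"
    using tpath_split[OF assms(1)] by blast
  have "q \<noteq> []"
    using assms(2) pq(2) is_path_tpath[of u v] by (auto simp: is_path_def)
  with pq show ?thesis by (cases q) auto
qed

lemma child_preceq: "child E r u v \<Longrightarrow> preceq E r u v"
  by (simp add: child_def)

lemma preceq_child_cases:
  assumes "preceq E r u v" "child E r x v" "u \<noteq> v"
  shows "preceq E r u x"
  using assms by (auto simp: preceq_iff child_iff)

lemma child_towards:
  assumes "preceq E r u v" "u \<noteq> v"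
  shows "\<exists>u'. child E r u u' \<and> preceq E r u' v"
proof -
  obtain p q where pq: "tpath E r u = p @ [u]" "tpath E u v = u # q" "tpath E r v = p @ u # q"
    using tpath_split[OF assms(1)] by blast
  obtain u' s where q: "q = u' # s"
    using assms(2) pq(2) is_path_tpath[of u v] by (cases q) (auto simp: is_path_def)
  have "is_path E r ((p @ [u]) @ u' # s) v"
    using is_path_tpath[of r v] pq q by simp
  then have "tpath E r u' = (p @ [u]) @ [u']"
    by (intro tpath_eqI is_path_split(1))
  with pq q show ?thesis by (auto simp: child_iff preceq_iff)
qed

text \<open>The root paths of \<open>x\<close> and \<open>y\<close> are prefixes of the root path of
  \<open>v\<close> and both have one vertex more than that of \<open>u\<close>, so they
  coincide.\<close>

lemma child_towards_unique:
  assumes "child E r u x" "child E r u y" "preceq E r x v" "preceq E r y v"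
  shows "x = y"
  using tpath_split[OF assms(3)] tpath_split[OF assms(4)] assms(1,2)
  by (auto simp: child_iff)

lemma tpath_child:
  assumes "child E r u u'" "preceq E r u' v"
  shows "tpath E u v = u # tpath E u' v"
  using tpath_split[OF assms(2)] assms(1)
    tpath_split[OF preceq_trans[OF child_preceq[OF assms(1)] assms(2)]]
  by (auto simp: child_iff)

text \<open>Induction from the leaves up to the root. A root path has distinct vertices, so its
  length is at most \<open>CARD('v)\<close>, and the remaining depth decreases from a vertex to its
  children.\<close>

lemma tree_induct [case_names child]:
  assumes "\<And>v. (\<And>u. child E r v u \<Longrightarrow> P u) \<Longrightarrow> P v"
  shows "P v"
proof (induction v rule: measure_induct_rule[of "\<lambda>v. CARD('v) - length (tpath E r v)"])
  case (less v)
  show ?case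
  proof (rule assms)
    fix u assume u: "child E r v u"
    have "length (tpath E r u) \<le> CARD('v)"
      using is_path_tpath[of r u] unfolding is_path_def
      by (metis card_mono distinct_card finite subset_UNIV)
    with u show "P u" by (intro less) (simp add: child_iff)
  qed
qed

lemma leaf_preceq: "v \<in> leaves E r \<Longrightarrow> preceq E r v u \<Longrightarrow> u = v"
  using child_towards by (fastforce simp: leaves_def)

lemma successively_child_tpath:
  "preceq E r u v \<Longrightarrow> successively (child E r) (tpath E u v)"
proof (induction u rule: tree_induct)
  case (child u)
  show ?case
  proof (cases "u = v")
    case False
    then obtain u' where u': "child E r u u'" "preceq E r u' v"
      using child_towards child.prems by blast
    with tpath_Cons[of u' v] child.IH[OF u'] show ?thesis
      by (auto simp: tpath_child[OF u'])
  qed simp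
qed

lemma set_tpath_preceq:
  assumes "preceq E r u v" "y \<in> set (tpath E u v)"
  shows "preceq E r u y"
  using assms
proof (induction u rule: tree_induct)
  case (child u)
  show ?case
  proof (cases "u = v")
    case False
    then obtain u' where u': "child E r u u'" "preceq E r u' v"
      using child_towards child.prems by blast
    with child show ?thesis
      by (auto simp: tpath_child[OF u'] intro: preceq_trans child_preceq)
  qed (use child in simp)
qed

end

section \<open>Averages over the leaves\<close>

locale weighted_tree = rooted_tree E r
  for E :: "'v::finite \<Rightarrow> 'v \<Rightarrow> bool" and r +
  fixes w :: "'v \<Rightarrow> 'v \<Rightarrow> real"
  assumes weight: "is_weight E r w"
begin

lemma weight_pos: "preceq E r u v \<Longrightarrow> w u v > 0"
  using weight by (simp add: is_weight_def)

lemma weight_path: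
  "us \<noteq> [] \<Longrightarrow> successively (child E r) us \<Longrightarrow>
    w (hd us) (last us) = (\<Prod>j<length us - 1. w (us ! j) (us ! Suc j))"
  using weight by (simp add: is_weight_def)

lemma weight_self [simp]: "w v v = 1"
  using weight_path[of "[v]"] by simp

text \<open>Both weights are products over the edges of a path; the two paths differ by the first
  edge only.\<close>

lemma weight_child:
  assumes "child E r u u'" "preceq E r u' v"
  shows "w u v = w u u' * w u' v"
proof -
  obtain q where q: "tpath E u' v = u' # q" using tpath_Cons by blast
  have s: "successively (child E r) (u' # q)" "last (u' # q) = v"
    using successively_child_tpath[OF assms(2)] is_path_tpath[of u' v] q
    by (simp_all add: is_path_def)
  have "w u v = (\<Prod>j<Suc (length q). w ((u # u' # q) ! j) ((u # u' # q) ! Suc j))"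
    using weight_path[of "u # u' # q"] s assms(1) by simp
  also have "\<dots> = w u u' * (\<Prod>j<length q. w ((u' # q) ! j) ((u' # q) ! Suc j))"
    unfolding prod.lessThan_Suc_shift by simp
  also have "(\<Prod>j<length q. w ((u' # q) ! j) ((u' # q) ! Suc j)) = w u' v"
    using weight_path[of "u' # q"] s by simp
  finally show ?thesis .
qed

text \<open>The network operator of the subtree below \<open>v\<close>, so that the operator at the
  root can be computed recursively. The operators are arbitrary: besides the relaxed projections,
  the identity on the reals is used to sum weights.\<close>

definition net :: "('v \<Rightarrow> 'x \<Rightarrow> 'x) \<Rightarrow> 'v \<Rightarrow> 'x \<Rightarrow> 'x::real_vector" where
  "net F v x = (\<Sum>l | l \<in> leaves E r \<and> preceq E r v l. w v l *\<^sub>R along E F v l x)"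

lemma net_leaf: "v \<in> leaves E r \<Longrightarrow> net F v x = F v x"
proof -
  assume v: "v \<in> leaves E r"
  then have "{l. l \<in> leaves E r \<and> preceq E r v l} = {v}"
    using leaf_preceq by auto
  then show ?thesis by (simp add: net_def along_def)
qed

text \<open>The leaves below an inner vertex are partitioned by the child through which they are
  reached; the weight and the path to each leaf factor through that child.\<close>

lemma net_child:
  assumes "v \<notin> leaves E r"
  shows "net F v x = (\<Sum>u | child E r v u. w v u *\<^sub>R net F u (F v x))"
proof -
  let ?L = "\<lambda>u. {l. l \<in> leaves E r \<and> preceq E r u l}"
  have un: "?L v = (\<Union>u\<in>{u. child E r v u}. ?L u)"
    using assms child_towards[of v] by (auto intro: preceq_trans child_preceq)
  have "net F v x = (\<Sum>u | child E r v u. \<Sum>l\<in>?L u. w v l *\<^sub>R along E F v l x)"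
    unfolding net_def un by (rule sum.UNION_disjoint) (auto dest: child_towards_unique)
  also have "\<dots> = (\<Sum>u | child E r v u. w v u *\<^sub>R net F u (F v x))"
    unfolding net_def scaleR_sum_right
  proof (intro sum.cong refl)
    fix u l assume "u \<in> {u. child E r v u}" "l \<in> ?L u"
    then have u: "child E r v u" "preceq E r u l" by auto
    show "w v l *\<^sub>R along E F v l x = w v u *\<^sub>R w u l *\<^sub>R along E F u l (F v x)"
      by (simp add: weight_child[OF u] tpath_child[OF u] along_def)
  qed
  finally show ?thesis .
qed

lemma weight_children: "v \<notin> leaves E r \<Longrightarrow> (\<Sum>u | child E r v u. w v u) = 1"
  using weight by (simp add: is_weight_def)

lemma weight_leaves: "(\<Sum>l | l \<in> leaves E r \<and> preceq E r v l. w v l) = 1"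
proof -
  \<comment> \<open>With every operator the identity, evaluation at 1 returns the sum of the
    weights, and the recursion over children keeps the value 1.\<close>
  have "net (\<lambda>_ x. x) v (1::real) = 1"
  proof (induction v rule: tree_induct)
    case (child v)
    then show ?case
      by (cases "v \<in> leaves E r") (simp_all add: net_leaf net_child weight_children)
  qed
  moreover have "fold (\<lambda>_ x. x) vs x = x" for vs :: "'v list" and x :: real
    by (induction vs) auto
  ultimately show ?thesis by (simp add: net_def along_def)
qed

end

section \<open>Strict contractions off the common kernel\<close>

lemma Re_hprod: "Re (hprod a x) = a \<bullet> x"
  by (simp add: hprod_def inner_vec_def inner_complex_def)

lemma hprod_add: "hprod a (x + y) = hprod a x + hprod a y"
  by (simp add: hprod_def algebra_simps sum.distrib)

lemma hprod_smult: "hprod a (k *s x) = k * hprod a x"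
  by (simp add: hprod_def sum_distrib_left algebra_simps)

lemma hprod_smult_left: "hprod (k *s a) x = cnj k * hprod a x"
  by (simp add: hprod_def sum_distrib_left algebra_simps)

lemma hprod_self: "hprod a a = of_real ((norm a)\<^sup>2)"
proof (rule complex_eqI)
  show "Im (hprod a a) = Im (of_real ((norm a)\<^sup>2))"
    by (simp add: hprod_def)
qed (simp add: Re_hprod power2_norm_eq_inner)

lemma scaleR_eq_smult: "t *\<^sub>R (x :: complex ^ 'd) = of_real t *s x"
  by (simp add: vec_eq_iff scaleR_conv_of_real[symmetric])

section \<open>Stability of strict contraction\<close>

definition kernel_of :: "complex ^ 'd ^ 'v \<Rightarrow> 'v set \<Rightarrow> (complex ^ 'd) set" where
  "kernel_of A U = {x. \<forall>u\<in>U. hprod (avec A u) x = 0}"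

text \<open>A paracontraction whose fixed points are exactly the kernel. The shrinking is strict for
  each vector but need not be uniform, which suits composition and averaging without tracking
  constants.\<close>

definition contracts_off :: "complex ^ 'd ^ 'v \<Rightarrow> 'v set \<Rightarrow> (complex ^ 'd \<Rightarrow> complex ^ 'd) \<Rightarrow> bool" where
  "contracts_off A U T \<longleftrightarrow>
     (\<forall>x. if x \<in> kernel_of A U then T x = x else norm (T x) < norm x)"

lemma contracts_off_le: "contracts_off A U T \<Longrightarrow> norm (T x) \<le> norm x"
  by (metis contracts_off_def less_imp_le order_refl)

text \<open>If \<open>S\<close> moves \<open>x\<close>, it shrinks it and \<open>T\<close> cannot
  undo this; if \<open>S\<close> fixes \<open>x\<close>, the behaviour of \<open>T\<close> at
  \<open>x\<close> decides.\<close>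

lemma contracts_off_comp:
  assumes "contracts_off A U T" "contracts_off A W S"
  shows "contracts_off A (U \<union> W) (\<lambda>x. T (S x))"
  unfolding contracts_off_def
proof
  fix x
  have k: "kernel_of A (U \<union> W) = kernel_of A U \<inter> kernel_of A W"
    by (auto simp: kernel_of_def)
  show "if x \<in> kernel_of A (U \<union> W) then T (S x) = x else norm (T (S x)) < norm x"
  proof (cases "x \<in> kernel_of A W")
    case True
    with assms show ?thesis by (simp add: k contracts_off_def)
  next
    case False
    then have "norm (S x) < norm x" using assms(2) by (simp add: contracts_off_def)
    with contracts_off_le[OF assms(1), of "S x"] False show ?thesis by (simp add: k)
  qed
qed

text \<open>In the triangle inequality one strictly shrunk term with positive weight makes the whole
  estimate strict.\<close>

lemma contracts_off_convex:
  assumes "finite I" and pos: "\<And>i. i \<in> I \<Longrightarrow> p i > 0" and one: "(\<Sum>i\<in>I. p i) = 1"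
    and T: "\<And>i. i \<in> I \<Longrightarrow> contracts_off A (U i) (T i)"
  shows "contracts_off A (\<Union>i\<in>I. U i) (\<lambda>x. \<Sum>i\<in>I. p i *\<^sub>R T i x)"
  unfolding contracts_off_def
proof
  fix x
  have k: "kernel_of A (\<Union>i\<in>I. U i) = {x. \<forall>i\<in>I. x \<in> kernel_of A (U i)}"
    by (auto simp: kernel_of_def)
  show "if x \<in> kernel_of A (\<Union>i\<in>I. U i) then (\<Sum>i\<in>I. p i *\<^sub>R T i x) = x
        else norm (\<Sum>i\<in>I. p i *\<^sub>R T i x) < norm x"
  proof (cases "\<forall>i\<in>I. x \<in> kernel_of A (U i)")
    case True
    then have "(\<Sum>i\<in>I. p i *\<^sub>R T i x) = (\<Sum>i\<in>I. p i *\<^sub>R x)"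
      using T by (intro sum.cong) (auto simp: contracts_off_def)
    with True one show ?thesis by (simp add: k scaleR_sum_left[symmetric])
  next
    case False
    then obtain j where j: "j \<in> I" "x \<notin> kernel_of A (U j)" by blast
    have "norm (\<Sum>i\<in>I. p i *\<^sub>R T i x) \<le> (\<Sum>i\<in>I. p i * norm (T i x))"
      using pos by (intro order_trans[OF norm_sum] sum_mono) (simp add: less_imp_le)
    also have "\<dots> < (\<Sum>i\<in>I. p i * norm x)"
    proof (rule sum_strict_mono_ex1[OF assms(1)])
      show "\<forall>i\<in>I. p i * norm (T i x) \<le> p i * norm x"
        using contracts_off_le[OF T] pos by (auto intro: mult_left_mono less_imp_le)
      show "\<exists>i\<in>I. p i * norm (T i x) < p i * norm x"
        using j T[OF j(1)] pos[OF j(1)]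
        by (auto simp: contracts_off_def intro!: bexI[of _ j])
    qed
    also have "\<dots> = norm x" using one by (simp add: sum_distrib_right[symmetric])
    finally show ?thesis using False by (auto simp: k)
  qed
qed

section \<open>Relaxed projections\<close>

lemma Prelax_eq:
  "Prelax A \<omega> v x =
     x - \<omega> v *\<^sub>R ((hprod (avec A v) x / of_real ((norm (avec A v))\<^sup>2)) *s avec A v)"
  by (simp add: Prelax_def Pop_def algebra_simps)

lemma linear_Prelax: "linear (Prelax A \<omega> v)"
  by (rule linearI)
    (simp_all add: Prelax_eq hprod_add hprod_smult add_divide_distrib algebra_simps
      scaleR_eq_smult)

lemma Prelax_kernel: "hprod (avec A v) x = 0 \<Longrightarrow> Prelax A \<omega> v x = x"
  by (simp add: Prelax_eq)

text \<open>With \<open>y\<close> the orthogonal projection of \<open>x\<close> onto the line of the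
  row, the squared norm drops by \<open>\<omega> v * (2 - \<omega> v) * (norm y)\<^sup>2\<close>,
  which is positive for parameters in \<open>(0, 2)\<close> unless \<open>y\<close>
  vanishes.\<close>

lemma contracts_off_Prelax:
  assumes a: "avec A v \<noteq> 0" and \<omega>: "\<omega> v \<in> {0<..<2}"
  shows "contracts_off A {v} (Prelax A \<omega> v)"
  unfolding contracts_off_def
proof
  fix x
  define k where "k = hprod (avec A v) x / of_real ((norm (avec A v))\<^sup>2)"
  define y where "y = k *s avec A v"
  have "k * hprod (avec A v) (avec A v) = hprod (avec A v) x"
    using a by (simp add: k_def hprod_self)
  then have "hprod y x = hprod y y"
    by (simp add: y_def hprod_smult hprod_smult_left)
  then have yx: "y \<bullet> x = y \<bullet> y"
    by (metis Re_hprod)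
  have P: "Prelax A \<omega> v x = x - \<omega> v *\<^sub>R y"
    by (simp add: Prelax_eq y_def k_def)
  have "(norm (Prelax A \<omega> v x))\<^sup>2 = (norm x)\<^sup>2 - \<omega> v * (2 - \<omega> v) * (norm y)\<^sup>2"
    unfolding P power2_norm_eq_inner
    using yx by (simp add: inner_diff_left inner_diff_right inner_commute[of x y] algebra_simps)
  moreover have "\<omega> v * (2 - \<omega> v) * (norm y)\<^sup>2 > 0" if "hprod (avec A v) x \<noteq> 0"
    using that a \<omega> by (simp add: y_def k_def)
  ultimately have "norm (Prelax A \<omega> v x) < norm x" if "hprod (avec A v) x \<noteq> 0"
    using that by (intro power2_less_imp_less[OF _ norm_ge_zero]) simp
  then show "if x \<in> kernel_of A {v} then Prelax A \<omega> v x = x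
      else norm (Prelax A \<omega> v x) < norm x"
    by (simp add: kernel_of_def Prelax_kernel)
qed

section \<open>Geometry of row spans and kernels\<close>

abbreviation row_span :: "complex ^ 'd ^ 'v \<Rightarrow> 'v set \<Rightarrow> (complex ^ 'd) set" where
  "row_span A U \<equiv> vec.span (avec A ` U)"

text \<open>A complex subspace is also a real one, so the theory of real inner product spaces
  applies to it.\<close>

lemma subspace_row_span: "subspace (row_span A U)"
  unfolding subspace_def scaleR_eq_smult
  by (auto intro: vec.span_zero vec.span_add vec.span_scale)

lemma row_span_Prelax:
  assumes "v \<in> U" "x \<in> row_span A U" shows "Prelax A \<omega> v x \<in> row_span A U"
  unfolding Prelax_eq scaleR_eq_smult
  using assms by (intro vec.span_diff vec.span_scale) (auto intro: vec.span_base)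

lemma row_span_orthogonal_kernel:
  assumes "x \<in> row_span A U" "n \<in> kernel_of A U" shows "x \<bullet> n = 0"
proof -
  have "hprod x n = 0"
    using assms(1)
  proof (induction rule: vec.span_induct_alt)
    case base
    show ?case by (simp add: hprod_def)
  next
    case (step k a y)
    have "hprod (k *s a + y) n = cnj k * hprod a n + hprod y n"
      by (simp add: hprod_def sum_distrib_left sum.distrib[symmetric] algebra_simps)
    with step assms(2) show ?case by (auto simp: kernel_of_def)
  qed
  then show ?thesis using Re_hprod[of x n] by simp
qed

lemma row_span_kernel_decomp:
  "\<exists>s n. s \<in> row_span A U \<and> n \<in> kernel_of A U \<and> x = s + n"
proof -
  have sp: "span (row_span A U) = row_span A U"
    using subspace_row_span by (simp add: span_eq_iff)
  obtain s n where sn: "s \<in> row_span A U" "\<And>y. y \<in> row_span A U \<Longrightarrow> orthogonal n y" "x = s + n"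
    using orthogonal_subspace_decomp_exists[of "row_span A U" x] unfolding sp by metis
  have "hprod (avec A u) n = 0" if "u \<in> U" for u
  proof (rule complex_eqI)
    have a: "avec A u \<in> row_span A U" using that by (auto intro: vec.span_base)
    show "Re (hprod (avec A u) n) = Re 0"
      using sn(2)[OF a] by (simp add: Re_hprod orthogonal_def inner_commute)
    \<comment> \<open>Real orthogonality controls only the real part of \<open>hprod\<close>. The
      complex span also contains \<open>\<i>\<close> times the row, and orthogonality to that
      multiple kills the imaginary part.\<close>
    have "\<i> *s avec A u \<in> row_span A U" using a by (rule vec.span_scale)
    from sn(2)[OF this] have "Re (hprod (\<i> *s avec A u) n) = 0"
      by (simp add: Re_hprod orthogonal_def inner_commute)
    then show "Im (hprod (avec A u) n) = Im 0" by (simp add: hprod_smult_left)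
  qed
  with sn show ?thesis by (auto simp: kernel_of_def)
qed

lemma norm_row_span_add_kernel:
  assumes "s \<in> row_span A U" "n \<in> kernel_of A U"
  shows "(norm (s + n))\<^sup>2 = (norm s)\<^sup>2 + (norm n)\<^sup>2"
  using row_span_orthogonal_kernel[OF assms]
  by (intro norm_add_Pythagorean) (simp add: orthogonal_def)

text \<open>The span component shrinks, the kernel component stays, and the two remain orthogonal,
  so Pythagoras compares the norms before and after.\<close>

lemma contracts_off_of_row_span:
  assumes "linear T" and inv: "\<And>s. s \<in> row_span A U \<Longrightarrow> T s \<in> row_span A U"
    and fixed: "\<And>n. n \<in> kernel_of A U \<Longrightarrow> T n = n"
    and contr: "\<And>s. s \<in> row_span A U \<Longrightarrow> norm (T s) \<le> \<alpha> * norm s" and "\<alpha> < 1"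
  shows "contracts_off A U T"
  unfolding contracts_off_def
proof
  fix x
  obtain s n where sn: "s \<in> row_span A U" "n \<in> kernel_of A U" "x = s + n"
    using row_span_kernel_decomp by blast
  have "norm (T x) < norm x" if "x \<notin> kernel_of A U"
  proof (rule power2_less_imp_less[OF _ norm_ge_zero])
    have "s \<noteq> 0" using that sn by auto
    then have "norm (T s) < norm s"
      using contr[OF sn(1)] \<open>\<alpha> < 1\<close> by (metis mult_less_cancel_right2 norm_ge_zero
          order.strict_trans1 zero_less_norm_iff not_less)
    then have "(norm (T s))\<^sup>2 < (norm s)\<^sup>2" by (simp add: power_strict_mono)
    moreover have "T x = T s + n"
      using sn fixed linear_add[OF assms(1)] by simp
    ultimately show "(norm (T x))\<^sup>2 < (norm x)\<^sup>2"
      using norm_row_span_add_kernel[OF sn(1,2)]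
        norm_row_span_add_kernel[OF inv[OF sn(1)] sn(2)] sn(3) by simp
  qed
  with fixed show "if x \<in> kernel_of A U then T x = x else norm (T x) < norm x" by simp
qed

text \<open>A vector of the row span lying in the kernel is orthogonal to itself, hence zero, so all
  other vectors of the span shrink strictly. The maximum of \<open>norm (T s)\<close> over the
  compact unit sphere of the span is then a constant below 1.\<close>

lemma contracts_off_uniform:
  assumes T: "contracts_off A U T" "linear T"
  shows "\<exists>\<alpha><1. 0 \<le> \<alpha> \<and> (\<forall>s\<in>row_span A U. norm (T s) \<le> \<alpha> * norm s)"
proof -
  let ?K = "row_span A U \<inter> sphere 0 1"
  have less: "norm (T s) < norm s" if "s \<in> row_span A U" "s \<noteq> 0" for s
  proof -
    have "s \<notin> kernel_of A U"
      using row_span_orthogonal_kernel[of s A U s] that by auto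
    with T show ?thesis by (simp add: contracts_off_def)
  qed
  show ?thesis
  proof (cases "?K = {}")
    \<comment> \<open>An empty unit sphere means a zero row span, where no maximum exists and the
      constant 0 serves.\<close>
    case True
    have "s = 0" if "s \<in> row_span A U" for s
    proof (rule ccontr)
      assume "s \<noteq> 0"
      then have "(1 / norm s) *\<^sub>R s \<in> ?K"
        using that subspace_scale[OF subspace_row_span] by auto
      with True show False by blast
    qed
    then show ?thesis using linear_0[OF T(2)] by (intro exI[of _ 0]) auto
  next
    case False
    have "compact ?K"
      by (intro closed_Int_compact closed_subspace subspace_row_span) simp
    moreover have "continuous_on ?K (\<lambda>s. norm (T s))"
      by (intro continuous_on_norm linear_continuous_on linear_conv_bounded_linear[THEN iffD1] T)
    ultimately obtain m where m: "m \<in> ?K" "\<And>s. s \<in> ?K \<Longrightarrow> norm (T s) \<le> norm (T m)"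
      using continuous_attains_sup[OF _ False] by metis
    have "norm (T s) \<le> norm (T m) * norm s" if s: "s \<in> row_span A U" for s
    proof (cases "s = 0")
      case True
      then show ?thesis using linear_0[OF T(2)] by simp
    next
      case False
      then have "(1 / norm s) *\<^sub>R s \<in> ?K"
        using s subspace_scale[OF subspace_row_span] by auto
      from m(2)[OF this] False show ?thesis
        by (simp add: linear_scale[OF T(2)] field_simps)
    qed
    moreover have "norm (T m) < 1" using less[of m] m(1) by (cases "m = 0") auto
    ultimately show ?thesis by auto
  qed
qed

section \<open>Products and averages of relaxed projections\<close>

lemma linear_fold: "(\<And>v. linear (F v)) \<Longrightarrow> linear (fold F vs)"
proof (induction vs)
  case (Cons v vs)
  then show ?case using linear_compose[of "F v" "fold F vs"] by (simp add: o_def)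
qed (simp add: linear_ident id_def)

lemma linear_along_Prelax: "linear (along E (Prelax A \<omega>) u v)"
  unfolding along_def by (intro linear_fold linear_Prelax)

lemma linear_weighted_sum:
  "(\<And>i. linear (T i)) \<Longrightarrow> linear (\<lambda>x. \<Sum>i\<in>I. p i *\<^sub>R T i x)"
  by (intro linear_compose_sum ballI linear_compose_scale_right)

lemma fold_Prelax_row_span:
  "set vs \<subseteq> U \<Longrightarrow> x \<in> row_span A U \<Longrightarrow> fold (Prelax A \<omega>) vs x \<in> row_span A U"
  by (induction vs arbitrary: x) (auto simp: row_span_Prelax)

lemma fold_Prelax_kernel:
  "set vs \<subseteq> U \<Longrightarrow> x \<in> kernel_of A U \<Longrightarrow> fold (Prelax A \<omega>) vs x = x"
  by (induction vs) (auto simp: kernel_of_def Prelax_kernel)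

lemma matrix_vector_row: "(A *v x) $ v = hprod (avec A v) x"
  by (simp add: matrix_vector_mult_def hprod_def avec_def)

text \<open>Since \<open>z\<close> solves the equation at \<open>v\<close>, the affine term cancels:
  errors evolve under the homogeneous operators.\<close>

lemma Qrelax_diff:
  assumes "A *v z = b"
  shows "Qrelax A b \<omega> v x - z = Prelax A \<omega> v (x - z)"
proof -
  have "hprod (avec A v) x = hprod (avec A v) (x - z) + b $ v"
    using hprod_add[of "avec A v" "x - z" z] assms matrix_vector_row[of A z v] by simp
  then show ?thesis
    unfolding Qrelax_def Qop_def Prelax_def Pop_def
    by (simp add: vec_eq_iff algebra_simps)
qed

lemma fold_Qrelax_diff:
  "A *v z = b \<Longrightarrow> fold (Qrelax A b \<omega>) vs x - z = fold (Prelax A \<omega>) vs (x - z)"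
  by (induction vs arbitrary: x) (simp_all add: Qrelax_diff)

text \<open>Any other solution differs from \<open>z\<close> by a nonzero kernel vector, which is
  orthogonal to \<open>z\<close> and adds to the norm.\<close>

lemma row_span_min_norm:
  assumes "A *v z = b" "z \<in> row_span A UNIV"
  shows "min_norm_solution A b z"
  unfolding min_norm_solution_def
proof (intro conjI allI impI assms(1))
  fix y assume y: "A *v y = b \<and> y \<noteq> z"
  then have "A *v (y - z) = 0" using assms by (simp add: matrix_vector_mult_diff_distrib)
  then have "y - z \<in> kernel_of A UNIV"
    by (auto simp: kernel_of_def matrix_vector_row[symmetric])
  from norm_row_span_add_kernel[OF assms(2) this] y
  show "norm z < norm y"
    by (intro power2_less_imp_less[OF _ norm_ge_zero]) simp
qed

lemma range_cadjoint: "cadjoint A *v y \<in> row_span A UNIV"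
proof -
  \<comment> \<open>The product with the adjoint is a combination of its columns, and these are the
    row vectors \<open>avec A v\<close>.\<close>
  have "column v (cadjoint A) = avec A v" for v
    by (simp add: column_def cadjoint_def avec_def map_matrix_def transpose_def vec_eq_iff)
  then show ?thesis
    unfolding matrix_mult_sum by (intro vec.span_sum vec.span_scale vec.span_base) simp
qed

section \<open>The network iteration\<close>

locale kaczmarz_network = weighted_tree E r w
  for E :: "'v::finite \<Rightarrow> 'v \<Rightarrow> bool" and r and w +
  fixes A :: "complex ^ 'd ^ 'v" and c :: nat and G :: "nat \<Rightarrow> 'v set"
    and g :: "nat \<Rightarrow> 'v" and \<omega> :: "'v \<Rightarrow> real"
  assumes rows: "\<forall>v. avec A v \<noteq> 0"
    and sub: "\<forall>i\<in>{1..c}. subnetwork E r (G i)"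
    and disj: "disjoint_family_on G {1..c}"
    and cover: "leaves E r \<subseteq> (\<Union>i\<in>{1..c}. G i)"
    and prec: "\<forall>i\<in>{1..c}. immediately_precedes E r (g i) (G i)"
    and adm: "admissible E r w A c G g \<omega>"
begin

section \<open>Shape of the subnetworks\<close>

lemma sub_down:
  assumes "i \<in> {1..c}" shows "preceq E r u v \<Longrightarrow> u \<in> G i \<Longrightarrow> v \<in> G i"
proof (induction u rule: tree_induct)
  case (child u)
  show ?case
  proof (cases "u = v")
    case False
    then obtain u' where u': "child E r u u'" "preceq E r u' v"
      using child_towards child.prems(1) by blast
    then have "u' \<in> G i"
      using sub assms child.prems(2) unfolding subnetwork_def by blast
    then show ?thesis by (rule child.IH[OF u'])
  qed (use child.prems in simp)
qed

lemma ex_minimal: "u \<in> G i \<Longrightarrow> \<exists>m. minimal_in E r (G i) m \<and> preceq E r m u"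
proof (induction "length (tpath E r u)" arbitrary: u rule: less_induct)
  case less
  show ?case
  proof (cases "minimal_in E r (G i) u")
    case False
    then obtain v where "v \<in> G i" "preceq E r v u" "v \<noteq> u"
      using less.prems by (auto simp: minimal_in_def)
    then show ?thesis using less.hyps preceq_length preceq_trans by meson
  qed auto
qed

lemma sub_nonempty: "i \<in> {1..c} \<Longrightarrow> \<exists>u. u \<in> G i"
  using sub unfolding subnetwork_def by blast

lemma prec_notin: "i \<in> {1..c} \<Longrightarrow> g i \<notin> G i"
  using prec unfolding immediately_precedes_def by blast

lemma minimal_child: "i \<in> {1..c} \<Longrightarrow> minimal_in E r (G i) u \<Longrightarrow> child E r (g i) u"
  using prec unfolding immediately_precedes_def by blast

text \<open>Some minimal vertex exists and is a child of \<open>g i\<close>, so closure under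
  siblings puts all children of \<open>g i\<close> in \<open>G i\<close>. A proper ancestor of such
  a child lying in \<open>G i\<close> would precede \<open>g i\<close> and force \<open>g i\<close>
  into \<open>G i\<close>.\<close>

lemma minimal_iff_child:
  assumes i: "i \<in> {1..c}" shows "minimal_in E r (G i) u \<longleftrightarrow> child E r (g i) u"
proof
  assume u: "child E r (g i) u"
  obtain y where "y \<in> G i" using sub_nonempty[OF i] by blast
  then obtain m where m: "minimal_in E r (G i) m" using ex_minimal by blast
  then have "child E r (g i) m" by (rule minimal_child[OF i])
  moreover have "m \<in> G i" using m by (simp add: minimal_in_def)
  ultimately have uG: "u \<in> G i"
    using u sub i unfolding subnetwork_def by blast
  show "minimal_in E r (G i) u"
    unfolding minimal_in_def
  proof (intro conjI ballI impI uG)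
    fix v assume v: "v \<in> G i" "preceq E r v u"
    show "v = u"
    proof (rule ccontr)
      assume "v \<noteq> u"
      then have "preceq E r v (g i)" using preceq_child_cases v u by blast
      then have "g i \<in> G i" using sub_down[OF i] v(1) by blast
      with prec_notin[OF i] show False by blast
    qed
  qed
qed (rule minimal_child[OF i])

text \<open>Minimal vertices are the children of \<open>g i\<close> and membership passes downwards.
  Hence a subnetwork is determined by its predecessor, and the induction over the tree can stop
  there.\<close>

lemma sub_eq_descendants:
  assumes i: "i \<in> {1..c}" shows "G i = {v. preceq E r (g i) v \<and> v \<noteq> g i}"
proof (intro set_eqI iffI CollectI conjI)
  fix v assume v: "v \<in> G i"
  then show "v \<noteq> g i" using prec_notin[OF i] by blast
  from ex_minimal[OF v] show "preceq E r (g i) v"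
    using minimal_iff_child[OF i] preceq_trans child_preceq by blast
next
  fix v assume "v \<in> {v. preceq E r (g i) v \<and> v \<noteq> g i}"
  then obtain u where "child E r (g i) u" "preceq E r u v"
    using child_towards by blast
  then have "u \<in> G i" using minimal_iff_child[OF i, of u] by (simp add: minimal_in_def)
  with \<open>preceq E r u v\<close> show "v \<in> G i" by (rule sub_down[OF i])
qed

lemma subroot_eq:
  assumes "i \<in> {1..c}" "child E r (g i) u" "preceq E r u l"
  shows "subroot E r (G i) l = u"
  unfolding subroot_def minimal_iff_child[OF assms(1)]
proof (rule the_equality)
  show "child E r (g i) u \<and> preceq E r u l" using assms(2,3) by simp
  show "v = u" if "child E r (g i) v \<and> preceq E r v l" for v
    using that assms(2,3) child_towards_unique[of "g i" v u l] by simp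
qed

text \<open>Otherwise the descendants of \<open>g i\<close>, hence all of \<open>G i\<close>, would
  lie in \<open>G j\<close>; disjointness then forces \<open>i = j\<close>.\<close>

lemma predecessor_not_in:
  assumes i: "i \<in> {1..c}" and j: "j \<in> {1..c}" shows "g i \<notin> G j"
proof
  assume gj: "g i \<in> G j"
  obtain u where u: "u \<in> G i" using sub_nonempty[OF i] by blast
  then have "preceq E r (g i) u" using sub_eq_descendants[OF i] by auto
  then have "u \<in> G j" using gj by (rule sub_down[OF j])
  with u disj i j have "i = j" unfolding disjoint_family_on_def by blast
  with gj prec_notin[OF i] show False by blast
qed

lemma leaves_below_predecessor:
  assumes i: "i \<in> {1..c}"
  shows "{l. l \<in> leaves E r \<and> preceq E r (g i) l} = G i \<inter> leaves E r"
proof -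
  have "g i \<notin> leaves E r" using cover predecessor_not_in[OF i] by blast
  with sub_eq_descendants[OF i] show ?thesis by auto
qed

text \<open>Every path from \<open>g i\<close> to a leaf continues at the subroot above that leaf,
  so the operator at \<open>g i\<close> splits off as the first factor and the weights
  agree.\<close>

lemma net_predecessor:
  assumes i: "i \<in> {1..c}"
  shows "net (Prelax A \<omega>) (g i) x = Psub E r w A \<omega> (g i) (G i) (Prelax A \<omega> (g i) x)"
  unfolding net_def Psub_def leaves_below_predecessor[OF i]
proof (intro sum.cong refl)
  fix l assume "l \<in> G i \<inter> leaves E r"
  then obtain u where u: "child E r (g i) u" "preceq E r u l"
    using sub_eq_descendants[OF i] child_towards by blast
  then show "w (g i) l *\<^sub>R along E (Prelax A \<omega>) (g i) l x =
      w (g i) l *\<^sub>R along E (Prelax A \<omega>) (subroot E r (G i) l) l (Prelax A \<omega> (g i) x)"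
    by (simp add: subroot_eq[OF i u] along_def tpath_child)
qed

section \<open>Contraction of subnetwork and network operators\<close>

lemma set_tpath_subroot:
  assumes i: "i \<in> {1..c}" and l: "l \<in> G i"
  shows "set (tpath E (subroot E r (G i) l) l) \<subseteq> G i"
proof -
  obtain u where u: "minimal_in E r (G i) u" "preceq E r u l" using ex_minimal l by blast
  have "subroot E r (G i) l = u"
    using u subroot_eq[OF i] minimal_child[OF i] by blast
  moreover have "u \<in> G i" using u(1) by (simp add: minimal_in_def)
  ultimately show ?thesis using u(2) set_tpath_preceq sub_down[OF i] by blast
qed

text \<open>Admissibility bounds the operator on the row span only. Its paths stay inside
  \<open>G i\<close>, so it preserves that span, and it fixes the kernel because the leaf weights
  sum to 1.\<close>

lemma contracts_off_Psub:
  assumes i: "i \<in> {1..c}"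
  shows "contracts_off A (G i) (Psub E r w A \<omega> (g i) (G i))"
proof -
  let ?T = "Psub E r w A \<omega> (g i) (G i)"
  obtain \<alpha> where \<alpha>: "\<alpha> < 1" "\<forall>s\<in>row_span A (G i). norm (?T s) \<le> \<alpha> * norm s"
    using adm i unfolding admissible_def by blast
  show ?thesis
  proof (rule contracts_off_of_row_span)
    show "linear ?T"
      unfolding Psub_def [abs_def] by (intro linear_weighted_sum linear_along_Prelax)
    show "?T s \<in> row_span A (G i)" if "s \<in> row_span A (G i)" for s
      unfolding Psub_def along_def
      using fold_Prelax_row_span[OF set_tpath_subroot[OF i] that]
      by (intro subspace_sum subspace_scale subspace_row_span) simp
    show "?T n = n" if "n \<in> kernel_of A (G i)" for n
    proof -
      have "?T n = (\<Sum>l\<in>G i \<inter> leaves E r. w (g i) l *\<^sub>R n)"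
        unfolding Psub_def along_def
        using fold_Prelax_kernel[OF set_tpath_subroot[OF i] that] by (intro sum.cong) simp_all
      also have "\<dots> = n"
        using weight_leaves[of "g i"] unfolding leaves_below_predecessor[OF i]
        by (simp add: scaleR_sum_left[symmetric])
      finally show ?thesis .
    qed
  qed (use \<alpha> in auto)
qed

text \<open>At a predecessor \<open>g i\<close> the subtree operator is the subnetwork operator
  after one relaxed projection. At any other vertex outside the subnetworks it is an average over
  children that are again outside them.\<close>

lemma contracts_off_net:
  assumes "v \<notin> (\<Union>i\<in>{1..c}. G i)"
  shows "contracts_off A {u. preceq E r v u} (net (Prelax A \<omega>) v)"
  using assms
proof (induction v rule: tree_induct)
  case (child v)
  have "\<omega> v \<in> {0<..<2}"
    using adm child.prems unfolding admissible_def by blast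
  with rows have Pv: "contracts_off A {v} (Prelax A \<omega> v)"
    by (intro contracts_off_Prelax) simp_all
  show ?case
  proof (cases "\<exists>i\<in>{1..c}. v = g i")
    case True
    then obtain i where i: "i \<in> {1..c}" "v = g i" by blast
    have "{u. preceq E r v u} = G i \<union> {v}"
      unfolding sub_eq_descendants[OF i(1)] i(2) by auto
    moreover have "net (Prelax A \<omega>) v = (\<lambda>x. Psub E r w A \<omega> (g i) (G i) (Prelax A \<omega> v x))"
      using net_predecessor[OF i(1)] unfolding i(2) by blast
    ultimately show ?thesis
      using contracts_off_comp[OF contracts_off_Psub[OF i(1)] Pv] by simp
  next
    case False
    have nl: "v \<notin> leaves E r" using child.prems cover by blast
    \<comment> \<open>A child in \<open>G i\<close> would be a proper descendant of
      \<open>g i\<close>, making its parent \<open>v\<close> either \<open>g i\<close> itself or a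
      member of \<open>G i\<close>.\<close>
    have "u \<notin> (\<Union>i\<in>{1..c}. G i)" if u: "child E r v u" for u
    proof
      assume "u \<in> (\<Union>i\<in>{1..c}. G i)"
      then obtain i where i: "i \<in> {1..c}" "preceq E r (g i) u" "u \<noteq> g i"
        using sub_eq_descendants by blast
      then have "preceq E r (g i) v" using preceq_child_cases[OF i(2) u] by blast
      moreover have "v \<noteq> g i" using False i(1) by blast
      ultimately have "v \<in> G i" using sub_eq_descendants[OF i(1)] by blast
      with child.prems i(1) show False by blast
    qed
    then have "contracts_off A {y. preceq E r u y} (net (Prelax A \<omega>) u)" if "child E r v u" for u
      using child.IH that by blast
    then have "contracts_off A (\<Union>u\<in>{u. child E r v u}. {y. preceq E r u y})
        (\<lambda>x. \<Sum>u | child E r v u. w v u *\<^sub>R net (Prelax A \<omega>) u x)"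
      using weight_children[OF nl]
      by (intro contracts_off_convex) (simp_all add: weight_pos child_preceq)
    note contracts_off_comp[OF this Pv]
    moreover have "net (Prelax A \<omega>) v =
        (\<lambda>x. \<Sum>u | child E r v u. w v u *\<^sub>R net (Prelax A \<omega>) u (Prelax A \<omega> v x))"
      using net_child[OF nl] by blast
    moreover have "(\<Union>u\<in>{u. child E r v u}. {y. preceq E r u y}) \<union> {v} = {u. preceq E r v u}"
      using child_towards[of v] by (auto intro: preceq_trans child_preceq)
    ultimately show ?thesis by simp
  qed
qed

section \<open>Convergence of the iteration\<close>

lemma root_not_in: "i \<in> {1..c} \<Longrightarrow> r \<notin> G i"
proof
  assume "i \<in> {1..c}" "r \<in> G i"
  \<comment> \<open>The path condition on subnetworks is applied to the trivial path at the
    root.\<close>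
  then have "r \<notin> set (tpath E r r)" using sub unfolding subnetwork_def by blast
  then show False by simp
qed

text \<open>The leaf weights sum to 1, so \<open>z\<close> can be subtracted inside the average,
  where each path product becomes homogeneous.\<close>

lemma Qnet_diff:
  assumes "A *v z = b"
  shows "Qnet E r w A b \<omega> x - z = net (Prelax A \<omega>) r (x - z)"
proof -
  have "Qnet E r w A b \<omega> x - z
      = (\<Sum>l\<in>leaves E r. w r l *\<^sub>R (along E (Qrelax A b \<omega>) r l x - z))"
    using weight_leaves[of r]
    by (simp add: Qnet_def scaleR_diff_right sum_subtractf scaleR_sum_left[symmetric])
  also have "\<dots> = net (Prelax A \<omega>) r (x - z)"
    by (simp add: net_def along_def fold_Qrelax_diff[OF assms])
  finally show ?thesis .
qed

lemma linear_net: "linear (net (Prelax A \<omega>) v)"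
  unfolding net_def [abs_def] by (intro linear_weighted_sum linear_along_Prelax)

lemma net_row_span:
  "s \<in> row_span A UNIV \<Longrightarrow> net (Prelax A \<omega>) v s \<in> row_span A UNIV"
  unfolding net_def along_def
  by (intro subspace_sum subspace_scale subspace_row_span fold_Prelax_row_span) auto

lemma iteration_tendsto:
  assumes z: "A *v z = b" "z \<in> row_span A UNIV" and x0: "x 0 \<in> row_span A UNIV"
    and x: "\<And>n. x (Suc n) = Qnet E r w A b \<omega> (x n)"
  shows "x \<longlonglongrightarrow> z"
proof -
  have "contracts_off A UNIV (net (Prelax A \<omega>) r)"
    using contracts_off_net[of r] root_not_in by simp
  then obtain \<alpha> where \<alpha>: "\<alpha> < 1" "0 \<le> \<alpha>"
    "\<And>s. s \<in> row_span A UNIV \<Longrightarrow> norm (net (Prelax A \<omega>) r s) \<le> \<alpha> * norm s"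
    using contracts_off_uniform[OF _ linear_net] by metis
  \<comment> \<open>Membership of the error in the row span is carried along, since the uniform
    bound is available only there.\<close>
  have err: "x n - z \<in> row_span A UNIV \<and> norm (x n - z) \<le> \<alpha> ^ n * norm (x 0 - z)" for n
  proof (induction n)
    case 0
    show ?case using x0 z by (auto intro: vec.span_diff)
  next
    case (Suc n)
    have "norm (net (Prelax A \<omega>) r (x n - z)) \<le> \<alpha> * norm (x n - z)"
      using Suc \<alpha>(3) by blast
    also have "\<dots> \<le> \<alpha> * (\<alpha> ^ n * norm (x 0 - z))"
      using Suc \<alpha>(2) by (intro mult_left_mono) auto
    finally show ?case
      using Suc net_row_span by (simp add: x Qnet_diff[OF z(1)] mult.assoc)
  qed
  have "(\<lambda>n. \<alpha> ^ n * norm (x 0 - z)) \<longlonglongrightarrow> 0"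
    using \<alpha> by (intro tendsto_mult_left_zero LIMSEQ_realpow_zero)
  then have "(\<lambda>n. x n - z) \<longlonglongrightarrow> 0"
    by (rule Lim_null_comparison[rotated]) (use err in auto)
  then show ?thesis by (simp add: LIM_zero_iff)
qed

end

theorem theorem2p8:
  fixes A :: "complex ^ 'd ^ 'v" and b :: "complex ^ 'v"
    and E :: "'v::finite \<Rightarrow> 'v \<Rightarrow> bool" and r :: 'v
    and w :: "'v \<Rightarrow> 'v \<Rightarrow> real"
    and c :: nat and G :: "nat \<Rightarrow> 'v set" and g :: "nat \<Rightarrow> 'v"
    and \<omega> :: "'v \<Rightarrow> real" and x :: "nat \<Rightarrow> complex ^ 'd"
  assumes "is_tree E"
    and "is_weight E r w"
    and "\<forall>v. avec A v \<noteq> 0"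
    and "\<forall>i\<in>{1..c}. subnetwork E r (G i)"
    and "disjoint_family_on G {1..c}"
    and "leaves E r \<subseteq> (\<Union>i\<in>{1..c}. G i)"
    and "\<forall>i\<in>{1..c}. immediately_precedes E r (g i) (G i)"
    and "admissible E r w A c G g \<omega>"
    and "\<exists>y. A *v y = b"
    and "x 0 \<in> range (\<lambda>y. cadjoint A *v y)"
    and "\<forall>n. x (Suc n) = Qnet E r w A b \<omega> (x n)"
  shows "\<exists>z. min_norm_solution A b z \<and> x \<longlonglongrightarrow> z"
proof -
  interpret kaczmarz_network E r w A c G g \<omega>
    using assms(1-8) by unfold_locales
  obtain y where y: "A *v y = b" using assms(9) by blast
  \<comment> \<open>The limit is the row span component of an arbitrary solution: removing the
    kernel component leaves a solution.\<close>
  obtain z n where zn: "z \<in> row_span A UNIV" "n \<in> kernel_of A UNIV" "y = z + n"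
    using row_span_kernel_decomp by blast
  have "A *v n = 0"
    using zn(2) by (simp add: kernel_of_def vec_eq_iff matrix_vector_row)
  with y zn(3) have z: "A *v z = b" by (simp add: matrix_vector_right_distrib)
  have "x 0 \<in> row_span A UNIV" using assms(10) range_cadjoint by auto
  with iteration_tendsto[OF z zn(1)] row_span_min_norm[OF z zn(1)] assms(11)
  show ?thesis by blast
qed

end
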